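(* Let $n\ge2$. Suppose $Q_0\in O(n)$ lies in the stable manifold of a stable equilibrium of $\dot Q=F(Q)$, i.e. all leading principal submatrices of $Q_0$ are invertible: $$\det(Q_0[1,\dots,k;\ 1,\dots,k])\neq 0,\qquad k=1,2,\dots,n.$$ Let $Q(t)=(q_{i,j}(t))$, $t\ge0$, be the solution of $\dot Q=F(Q)$, $Q(0)=Q_0$. Define $$\nu_k=\min\{\lambda_1-\lambda_2,\ \lambda_2-\lambda_3,\ \dots,\ \lambda_k-\lambda_{k+1}\}>0,\quad k=1,\dots,n-1,\qquad \nu_n=\nu_{n-1}.$$ Then there exists a constant $C>0$ such that for all $t\ge0$ $$|q_{i,j}^2(t)-\delta_{i,j}|\le Ce^{-2\nu_{i\wedge j}t},\qquad i,j=1,2,\dots,n,$$ where $\delta_{i,j}$ is the Kronecker delta and $i\wedge j=\min\{i,j\}$.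
   Context: $A=\mathrm{diag}\{\lambda_1,\dots,\lambda_n\}\in\mathbb{R}^{n\times n}$ with $\lambda_1>\lambda_2>\dots>\lambda_n>0$. $O(n)=\{Q\in\mathbb{R}^{n\times n}: Q^TQ=I_n\}$. $E_j$ denotes the $n\times n$ matrix with entry $1$ at position $(j,j)$ and $0$ elsewhere, and $$F(Q)=Q\sum_{j=1}^n\sum_{k=1}^{j-1}\left(E_jQ^TAQE_k-E_kQ^TAQE_j\right).$$ $M[a_1,\dots,a_r;\,b_1,\dots,b_c]$ denotes the submatrix of $M$ formed from rows $a_1,\dots,a_r$ and columns $b_1,\dots,b_c$. The stable equilibria of $\dot Q=F(Q)$ on $O(n)$ are the matrices $\mathrm{diag}\{\varepsilon_1,\dots,\varepsilon_n\}$, $\varepsilon_i=\pm1$; the stable manifold of an equilibrium is the set of initial data whose $\omega$-limit set is that equilibrium. *)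

theory Defs
  imports Complex_Main "Jordan_Normal_Form.Determinant" "Jordan_Normal_Form.DL_Submatrix"
begin

text \<open>Rows, columns and eigenvalues are indexed by \<open>0, \<dots>, n - 1\<close>: the eigenvalue \<open>lam i\<close> is
  the mathematical \<open>\<lambda>\<^sub>i\<^sub>+\<^sub>1\<close>, and the matrix entry \<open>(i, j)\<close> is the mathematical entry
  \<open>(i + 1, j + 1)\<close>.\<close>

text \<open>The library predicate \<open>orthogonal_mat\<close> only asks for pairwise orthogonal nonzero columns
  (no normalization), so it does not describe \<open>O(n)\<close>.\<close>

definition orthogonal_group :: "nat \<Rightarrow> real mat set" where
  "orthogonal_group n = {Q \<in> carrier_mat n n. transpose_mat Q * Q = 1\<^sub>m n}"

definition unit_diag :: "nat \<Rightarrow> nat \<Rightarrow> real mat" where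
  "unit_diag n j = mat_diag n (\<lambda>i. if i = j then 1 else 0)"

text \<open>The type of matrices carries no \<open>comm_monoid_add\<close> structure, since dimensions vary; the sum
  of matrices in the vector field is therefore taken entrywise.\<close>

definition skew_part :: "nat \<Rightarrow> real mat \<Rightarrow> real mat \<Rightarrow> real mat" where
  "skew_part n A Q = mat n n (\<lambda>rc. \<Sum>j<n. \<Sum>k<j.
     (unit_diag n j * transpose_mat Q * A * Q * unit_diag n k
      - unit_diag n k * transpose_mat Q * A * Q * unit_diag n j) $$ rc)"

definition flow_field :: "nat \<Rightarrow> real mat \<Rightarrow> real mat \<Rightarrow> real mat" where
  "flow_field n A Q = Q * skew_part n A Q"

text \<open>The derivative of a matrix-valued curve is entrywise, one-sided at \<open>t = 0\<close>.\<close>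

definition flow_solution :: "nat \<Rightarrow> real mat \<Rightarrow> (real \<Rightarrow> real mat) \<Rightarrow> bool" where
  "flow_solution n A Q \<longleftrightarrow>
     (\<forall>t\<ge>0. Q t \<in> carrier_mat n n \<and>
        (\<forall>i<n. \<forall>j<n.
           ((\<lambda>s. Q s $$ (i, j)) has_real_derivative flow_field n A (Q t) $$ (i, j))
             (at t within {0..})))"

text \<open>\<open>gap_rate n lam k\<close> is the mathematical \<open>\<nu>\<^sub>k\<^sub>+\<^sub>1\<close>, for \<open>k < n\<close> and \<open>n \<ge> 2\<close>; the last
  value repeats the last but one.\<close>

definition gap_rate :: "nat \<Rightarrow> (nat \<Rightarrow> real) \<Rightarrow> nat \<Rightarrow> real" where
  "gap_rate n lam k =
     Min ((\<lambda>l. lam l - lam (Suc l)) ` {..(if k < n - 1 then k else n - 2)})"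

end

theory Submission
  imports Defs
begin

text \<open>On \<open>O(n)\<close> the equation reads \<open>Q' = A Q - Q U\<close> with \<open>U\<close> upper triangular, so the span of the
  first \<open>k\<close> columns evolves by \<open>exp(t A)\<close>.  If the leading principal \<open>k \<times> k\<close> minor of \<open>Q\<^sub>0\<close> is
  nonzero, the initial span is the graph of a linear map from the first \<open>k\<close> coordinates to the
  others, and conjugation by \<open>exp(t A)\<close> contracts this map at rate \<open>\<lambda>\<^sub>k - \<lambda>\<^sub>k\<^sub>+\<^sub>1\<close>; this bounds the
  lower left block.  In an orthogonal matrix the upper right block has the same Frobenius norm, and
  the unit length of the rows then controls the diagonal entries.\<close>

section \<open>Monotonicity and uniqueness for differential equations on the half-line\<close>

lemma has_nonpos_derivative_imp_le_initial:
  fixes f :: "real \<Rightarrow> real"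
  assumes deriv: "\<And>t. t \<ge> 0 \<Longrightarrow> (f has_real_derivative f' t) (at t within {0..})"
    and nonpos: "\<And>t. t \<ge> 0 \<Longrightarrow> f' t \<le> 0" and "t \<ge> 0"
  shows "f t \<le> f 0"
proof (rule DERIV_nonpos_imp_decreasing_open[OF \<open>t \<ge> 0\<close>])
  fix x :: real assume "0 < x" "x < t"
  \<comment> \<open>At an interior point the one-sided derivative is two-sided; the endpoint 0
    enters only through continuity.\<close>
  moreover from this have "at x within {0..} = at x"
    by (intro at_within_open_subset[of _ "{0<..}"]) auto
  ultimately show "\<exists>y. (f has_real_derivative y) (at x) \<and> y \<le> 0"
    using deriv[of x] nonpos[of x] by auto
next
  have "continuous_on {0..} f"
    unfolding continuous_on_eq_continuous_within
    using deriv DERIV_continuous by (metis atLeast_iff)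
  then show "continuous_on {0..t} f"
    by (rule continuous_on_subset) auto
qed

lemma has_zero_derivative_imp_eq_initial:
  fixes f :: "real \<Rightarrow> real"
  assumes deriv: "\<And>t. t \<ge> 0 \<Longrightarrow> (f has_real_derivative 0) (at t within {0..})" and "t \<ge> 0"
  shows "f t = f 0"
  using has_nonpos_derivative_imp_le_initial[of f "\<lambda>_. 0", OF deriv _ \<open>t \<ge> 0\<close>]
    has_nonpos_derivative_imp_le_initial[of "\<lambda>t. - f t" "\<lambda>_. 0", OF _ _ \<open>t \<ge> 0\<close>]
    DERIV_minus[OF deriv] by force

text \<open>Gronwall's argument: the squared norm \<open>N\<close> satisfies
  \<open>N' \<le> \<kappa> N\<close>, so \<open>exp (- \<kappa> t) N\<close> does not increase from
  its initial value 0. The row-vector form \<open>g' = g W\<close> suits the columns of the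
  flow.\<close>

lemma linear_ode_zero_unique:
  fixes g :: "real \<Rightarrow> 'i \<Rightarrow> real"
  assumes "finite I"
    and deriv: "\<And>t l. t \<ge> 0 \<Longrightarrow> l \<in> I \<Longrightarrow>
      ((\<lambda>s. g s l) has_real_derivative (\<Sum>m\<in>I. W t m l * g t m)) (at t within {0..})"
    and bound: "\<And>t m l. t \<ge> 0 \<Longrightarrow> m \<in> I \<Longrightarrow> l \<in> I \<Longrightarrow> \<bar>W t m l\<bar> \<le> \<beta>"
    and zero: "\<And>l. l \<in> I \<Longrightarrow> g 0 l = 0"
    and "t \<ge> 0" "l \<in> I"
  shows "g t l = 0"
proof -
  define N where "N t = (\<Sum>l\<in>I. (g t l)\<^sup>2)" for t
  define N' where "N' t = (\<Sum>l\<in>I. 2 * g t l * (\<Sum>m\<in>I. W t m l * g t m))" for t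
  \<comment> \<open>After expansion \<open>N'\<close> has one product per pair of indices, and each
    is at most \<open>2 * \<beta> * N\<close>.\<close>
  define \<kappa> where "\<kappa> = (\<Sum>l\<in>I. \<Sum>m\<in>I. 2 * \<beta>)"
  have N: "(N has_real_derivative N' t) (at t within {0..})" if "t \<ge> 0" for t
    unfolding N_def N'_def
    by (auto intro!: derivative_eq_intros deriv[OF that] sum.cong simp: mult_ac)
  have component: "(g t l)\<^sup>2 \<le> N t" if "l \<in> I" for t l
    unfolding N_def by (rule member_le_sum) (use that \<open>finite I\<close> in auto)
  have N_le: "N' t \<le> \<kappa> * N t" if "t \<ge> 0" for t
  proof -
    have "2 * g t l * (W t m l * g t m) \<le> 2 * \<beta> * N t" if "l \<in> I" "m \<in> I" for l m
    proof -
      have "2 * (\<bar>g t l\<bar> * \<bar>g t m\<bar>) \<le> (g t l)\<^sup>2 + (g t m)\<^sup>2"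
        using sum_squares_bound[of "\<bar>g t l\<bar>" "\<bar>g t m\<bar>"] by (simp add: mult_ac)
      then have prod: "\<bar>g t l\<bar> * \<bar>g t m\<bar> \<le> N t"
        using component[OF that(1), of t] component[OF that(2), of t] by linarith
      have "g t l * (W t m l * g t m) \<le> \<bar>g t l * (W t m l * g t m)\<bar>"
        by (rule abs_ge_self)
      also have "\<dots> = \<bar>W t m l\<bar> * (\<bar>g t l\<bar> * \<bar>g t m\<bar>)"
        by (simp add: abs_mult)
      also have "\<dots> \<le> \<beta> * N t"
        using bound[OF \<open>t \<ge> 0\<close> that(2,1)] prod by (intro mult_mono) auto
      finally show ?thesis by simp
    qed
    then show ?thesis
      unfolding N'_def \<kappa>_def sum_distrib_left sum_distrib_right by (intro sum_mono)
  qed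
  have "exp (- \<kappa> * t) * N t \<le> exp (- \<kappa> * 0) * N 0"
  proof (rule has_nonpos_derivative_imp_le_initial[OF _ _ \<open>t \<ge> 0\<close>])
    fix s :: real assume "s \<ge> 0"
    show "((\<lambda>s. exp (- \<kappa> * s) * N s) has_real_derivative exp (- \<kappa> * s) * (N' s - \<kappa> * N s))
        (at s within {0..})"
      by (auto intro!: derivative_eq_intros N[OF \<open>s \<ge> 0\<close>] simp: algebra_simps)
    show "exp (- \<kappa> * s) * (N' s - \<kappa> * N s) \<le> 0"
      using N_le[OF \<open>s \<ge> 0\<close>] by (simp add: mult_nonneg_nonpos)
  qed
  also have "\<dots> = 0"
    by (simp add: N_def zero)
  finally have "N t \<le> 0"
    by (simp add: mult_le_0_iff)
  then show ?thesis
    using component[OF \<open>l \<in> I\<close>, of t] by (smt (verit) zero_le_power2 zero_eq_power2)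
qed

section \<open>Leading blocks and orthogonal matrices\<close>

lemma leading_submatrix:
  assumes "A \<in> carrier_mat n n" "k \<le> n"
  shows "submatrix A {..<k} {..<k} \<in> carrier_mat k k"
    and "i < k \<Longrightarrow> j < k \<Longrightarrow> submatrix A {..<k} {..<k} $$ (i, j) = A $$ (i, j)"
proof -
  have "{i. i < n \<and> i \<in> {..<k}} = {..<k}"
    using assms by auto
  then show "submatrix A {..<k} {..<k} \<in> carrier_mat k k"
    using assms by (intro carrier_matI) (simp_all add: dim_submatrix)
  assume "i < k" "j < k"
  \<comment> \<open>Entries of a submatrix are addressed by rank in the selecting set; in an initial
    segment the rank of \<open>i\<close> is \<open>i\<close>.\<close>
  moreover have "{a \<in> {..<k}. a < i} = {..<i}" if "i < k" for i
    using that by auto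
  ultimately show "submatrix A {..<k} {..<k} $$ (i, j) = A $$ (i, j)"
    using submatrix_index_card[of i A j "{..<k}" "{..<k}"] assms by simp
qed

text \<open>The rows of an invertible block span all row vectors of length \<open>k\<close>; the
  coefficients are \<open>b\<close> times the inverse block. With \<open>b\<close> taken from a
  lower row of \<open>A\<close>, this describes the graph of a linear map over the first
  \<open>k\<close> coordinates.\<close>

lemma row_combination_of_leading_rows:
  fixes A :: "real mat"
  assumes A: "A \<in> carrier_mat n n" and "k \<le> n"
    and det: "Determinant.det (submatrix A {..<k} {..<k}) \<noteq> 0"
  obtains c where "\<And>l. l < k \<Longrightarrow> b l = (\<Sum>i<k. c i * A $$ (i, l))"
proof -
  define S where "S = submatrix A {..<k} {..<k}"
  have S: "S \<in> carrier_mat k k"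
    unfolding S_def using leading_submatrix(1)[OF A \<open>k \<le> n\<close>] .
  from det_non_zero_imp_unit[OF S, of "()"] det obtain T
    where T: "T \<in> carrier_mat k k" and TS: "T * S = 1\<^sub>m k"
    unfolding S_def Units_def ring_mat_def by auto
  have inv: "(\<Sum>i<k. T $$ (m, i) * A $$ (i, l)) = (if m = l then 1 else 0)"
    if "m < k" "l < k" for m l
  proof -
    have "(T * S) $$ (m, l) = (\<Sum>i<k. T $$ (m, i) * S $$ (i, l))"
      using S T that by (simp add: scalar_prod_def atLeast0LessThan)
    then show ?thesis
      using that leading_submatrix(2)[OF A \<open>k \<le> n\<close>] unfolding TS by (simp add: S_def)
  qed
  show thesis
  proof (rule that)
    fix l assume "l < k"
    have "(\<Sum>i<k. (\<Sum>m<k. b m * T $$ (m, i)) * A $$ (i, l))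
        = (\<Sum>m<k. b m * (\<Sum>i<k. T $$ (m, i) * A $$ (i, l)))"
      unfolding sum_distrib_left sum_distrib_right by (subst sum.swap) (simp add: mult_ac)
    also have "\<dots> = (\<Sum>m<k. if m = l then b m else 0)"
      by (rule sum.cong) (simp_all add: inv \<open>l < k\<close>)
    also have "\<dots> = b l"
      using \<open>l < k\<close> by simp
    finally show "b l = (\<Sum>i<k. (\<Sum>m<k. b m * T $$ (m, i)) * A $$ (i, l))" ..
  qed
qed

text \<open>A one-sided inverse of a square matrix is two-sided.\<close>

lemma orthonormal_rows_imp_columns:
  fixes A :: "real mat"
  assumes A: "A \<in> carrier_mat n n"
    and rows: "\<And>i j. i < n \<Longrightarrow> j < n \<Longrightarrow>
      (\<Sum>l<n. A $$ (i, l) * A $$ (j, l)) = (if i = j then 1 else 0)"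
    and "i < n" "j < n"
  shows "(\<Sum>l<n. A $$ (l, i) * A $$ (l, j)) = (if i = j then 1 else 0)"
proof -
  have "A * transpose_mat A = 1\<^sub>m n"
    using A rows by (intro eq_matI) (auto simp: scalar_prod_def atLeast0LessThan)
  then have "transpose_mat A * A = 1\<^sub>m n"
    using mat_mult_left_right_inverse[OF A] A by simp
  then have "(transpose_mat A * A) $$ (i, j) = (if i = j then 1 else 0)"
    using assms by simp
  then show ?thesis
    using A \<open>i < n\<close> \<open>j < n\<close> by (simp add: scalar_prod_def atLeast0LessThan)
qed

text \<open>The first \<open>k\<close> rows and the first \<open>k\<close> columns both have total
  squared norm \<open>k\<close>; removing the common \<open>k\<close> by \<open>k\<close> block
  leaves the two off-diagonal blocks.\<close>

lemma orthogonal_off_diagonal_blocks: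
  fixes q :: "nat \<Rightarrow> nat \<Rightarrow> real"
  assumes rows: "\<And>i. i < n \<Longrightarrow> (\<Sum>j<n. (q i j)\<^sup>2) = 1"
    and columns: "\<And>j. j < n \<Longrightarrow> (\<Sum>i<n. (q i j)\<^sup>2) = 1"
    and "k \<le> n"
  shows "(\<Sum>i<k. \<Sum>j=k..<n. (q i j)\<^sup>2) = (\<Sum>i=k..<n. \<Sum>j<k. (q i j)\<^sup>2)"
proof -
  have split: "(\<Sum>j<n. f j) = (\<Sum>j<k. f j) + (\<Sum>j=k..<n. f j)" for f :: "nat \<Rightarrow> real"
    using sum.atLeastLessThan_concat[of 0 k n f] \<open>k \<le> n\<close> by (simp add: atLeast0LessThan)
  have "(\<Sum>i<k. \<Sum>j<n. (q i j)\<^sup>2) = (\<Sum>j<k. \<Sum>i<n. (q i j)\<^sup>2)"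
    using rows columns \<open>k \<le> n\<close> by simp
  also have "\<dots> = (\<Sum>i<n. \<Sum>j<k. (q i j)\<^sup>2)"
    by (rule sum.swap)
  finally show ?thesis
    by (simp add: split sum.distrib)
qed

section \<open>The vector field and the flow in coordinates\<close>

text \<open>Multiplying by \<open>unit_diag n j\<close> on the left and \<open>unit_diag n k\<close>
  on the right isolates the entry \<open>(j, k)\<close> of \<open>Q^T A Q\<close>. As
  \<open>k < j\<close>, the first products give the strictly lower part and the subtracted ones, by
  symmetry, its negated transpose.\<close>

lemma skew_part_entry:
  assumes Q: "Q \<in> carrier_mat n n" and "r < n" "c < n"
  shows "skew_part n (mat_diag n lam) Q $$ (r, c) =
    (if c < r then 1 else if r < c then -1 else 0) * (\<Sum>i<n. lam i * Q $$ (i, r) * Q $$ (i, c))"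
proof -
  define B where "B = transpose_mat Q * mat_diag n lam * Q"
  have B: "B \<in> carrier_mat n n"
    unfolding B_def using Q by (intro mult_carrier_mat) auto
  have entry: "B $$ (r, c) = (\<Sum>i<n. lam i * Q $$ (i, r) * Q $$ (i, c))"
    using Q \<open>r < n\<close> \<open>c < n\<close> unfolding B_def
    by (subst mat_diag_mult_right[of _ n]) (auto simp: scalar_prod_def atLeast0LessThan mult_ac)
  have assoc: "unit_diag n j * transpose_mat Q * mat_diag n lam * Q * unit_diag n k
      = unit_diag n j * B * unit_diag n k" for j k
  proof -
    have D: "mat_diag n lam \<in> carrier_mat n n" "unit_diag n j \<in> carrier_mat n n"
      "transpose_mat Q \<in> carrier_mat n n"
      using Q by (auto simp: unit_diag_def)
    then show ?thesis
      using Q unfolding B_def by (simp add: assoc_mult_mat[of _ n n _ n _ n])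
  qed
  have corner: "(unit_diag n j * B * unit_diag n k) $$ (r, c)
      = (if j = r then (if k = c then B $$ (r, c) else 0) else 0)" for j k
    using B \<open>r < n\<close> \<open>c < n\<close> unfolding unit_diag_def
    by (simp add: mat_diag_mult_left[of _ n n] mat_diag_mult_right[of _ n n])
  have dims: "unit_diag n j * B * unit_diag n k \<in> carrier_mat n n" for j k
    using B by (intro mult_carrier_mat) (auto simp: unit_diag_def)
  have diff: "(unit_diag n j * B * unit_diag n k - unit_diag n k * B * unit_diag n j) $$ (r, c)
      = (unit_diag n j * B * unit_diag n k) $$ (r, c) - (unit_diag n k * B * unit_diag n j) $$ (r, c)"
    for j k
    by (rule index_minus_mat(1)) (use carrier_matD[OF dims] \<open>r < n\<close> \<open>c < n\<close> in auto)
  have "skew_part n (mat_diag n lam) Q $$ (r, c) = (\<Sum>j<n. \<Sum>k<j.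
      (if j = r then (if k = c then B $$ (r, c) else 0) else 0)
      - (if k = r then (if j = c then B $$ (r, c) else 0) else 0))"
    using \<open>r < n\<close> \<open>c < n\<close> by (simp add: skew_part_def assoc diff corner)
  also have "\<dots> = (\<Sum>j<n. (if j = r then (if c < j then B $$ (r, c) else 0) else 0)
      - (if j = c then (if r < j then B $$ (r, c) else 0) else 0))"
    by (rule sum.cong) (auto simp: sum_subtractf)
  also have "\<dots> = (if c < r then B $$ (r, c) else 0) - (if r < c then B $$ (r, c) else 0)"
    using \<open>r < n\<close> \<open>c < n\<close> by (simp add: sum_subtractf)
  finally show ?thesis
    by (simp add: entry)
qed

locale qr_flow =
  fixes n :: nat and lam :: "nat \<Rightarrow> real" and Q :: "real \<Rightarrow> real mat"
  assumes solution: "flow_solution n (mat_diag n lam) Q"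
    and initial: "Q 0 \<in> orthogonal_group n"
begin

definition q :: "real \<Rightarrow> nat \<Rightarrow> nat \<Rightarrow> real" where
  "q t i j = Q t $$ (i, j)"

text \<open>These are the entries of the symmetric matrix \<open>Q^T A Q\<close>.\<close>

definition B :: "real \<Rightarrow> nat \<Rightarrow> nat \<Rightarrow> real" where
  "B t r c = (\<Sum>i<n. lam i * q t i r * q t i c)"

definition K :: "real \<Rightarrow> nat \<Rightarrow> nat \<Rightarrow> real" where
  "K t r c = (if c < r then B t r c else if r < c then - B t r c else 0)"

text \<open>Splitting \<open>B\<close> into a skew and an upper triangular matrix leaves the
  diagonal of \<open>B\<close> and twice its strictly upper part in \<open>U\<close>.\<close>

definition U :: "real \<Rightarrow> nat \<Rightarrow> nat \<Rightarrow> real" where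
  "U t r c = B t r c - K t r c"

lemma carrier: "t \<ge> 0 \<Longrightarrow> Q t \<in> carrier_mat n n"
  using solution by (simp add: flow_solution_def)

lemma B_sym: "B t r c = B t c r"
  by (simp add: B_def mult_ac)

lemma K_skew: "K t r c = - K t c r"
  by (auto simp: K_def B_sym[of t r c])

lemma U_upper_triangular: "c < r \<Longrightarrow> U t r c = 0"
  by (simp add: U_def K_def)

lemma q_deriv:
  assumes "t \<ge> 0" "i < n" "j < n"
  shows "((\<lambda>s. q s i j) has_real_derivative (\<Sum>l<n. q t i l * K t l j)) (at t within {0..})"
proof -
  have "skew_part n (mat_diag n lam) (Q t) \<in> carrier_mat n n"
    by (simp add: skew_part_def)
  then have "flow_field n (mat_diag n lam) (Q t) $$ (i, j)
      = (\<Sum>l<n. q t i l * skew_part n (mat_diag n lam) (Q t) $$ (l, j))"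
    using carrier[OF \<open>t \<ge> 0\<close>] assms
    by (simp add: flow_field_def scalar_prod_def atLeast0LessThan q_def)
  also have "\<dots> = (\<Sum>l<n. q t i l * K t l j)"
    by (rule sum.cong)
      (auto simp: skew_part_entry[OF carrier[OF \<open>t \<ge> 0\<close>]] K_def B_def q_def \<open>j < n\<close>)
  finally have "flow_field n (mat_diag n lam) (Q t) $$ (i, j) = (\<Sum>l<n. q t i l * K t l j)" .
  then show ?thesis
    using solution assms unfolding flow_solution_def q_def by metis
qed

text \<open>From \<open>Q' = Q K\<close> with \<open>K\<close> skew, the derivative of
  \<open>Q Q^T\<close> is \<open>Q (K + K^T) Q^T = 0\<close>. Rows come first because
  \<open>Q^T Q\<close> would only satisfy a commutator equation.\<close>

lemma rows_orthonormal:
  assumes "t \<ge> 0" "i < n" "j < n"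
  shows "(\<Sum>l<n. q t i l * q t j l) = (if i = j then 1 else 0)"
proof -
  have "(\<Sum>l<n. q t i l * q t j l) = (\<Sum>l<n. q 0 i l * q 0 j l)"
  proof (rule has_zero_derivative_imp_eq_initial[OF _ \<open>t \<ge> 0\<close>])
    fix t :: real assume "t \<ge> 0"
    have "((\<lambda>s. \<Sum>l<n. q s i l * q s j l) has_real_derivative
        (\<Sum>l<n. q t i l * (\<Sum>m<n. q t j m * K t m l) + (\<Sum>m<n. q t i m * K t m l) * q t j l))
        (at t within {0..})"
      by (intro DERIV_sum DERIV_mult' q_deriv) (use \<open>t \<ge> 0\<close> assms in auto)
    also have "(\<Sum>l<n. q t i l * (\<Sum>m<n. q t j m * K t m l) + (\<Sum>m<n. q t i m * K t m l) * q t j l)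
        = (\<Sum>l<n. \<Sum>m<n. q t i l * q t j m * K t m l) + (\<Sum>l<n. \<Sum>m<n. q t i m * q t j l * K t m l)"
      by (simp add: sum.distrib sum_distrib_left sum_distrib_right mult_ac)
    also have "(\<Sum>l<n. \<Sum>m<n. q t i m * q t j l * K t m l)
        = (\<Sum>l<n. \<Sum>m<n. q t i l * q t j m * K t l m)"
      by (rule sum.swap)
    also have "(\<Sum>l<n. \<Sum>m<n. q t i l * q t j m * K t m l)
        = - (\<Sum>l<n. \<Sum>m<n. q t i l * q t j m * K t l m)"
      unfolding sum_negf[symmetric] by (intro sum.cong refl) (subst K_skew, simp)
    finally show "((\<lambda>s. \<Sum>l<n. q s i l * q s j l) has_real_derivative 0) (at t within {0..})"
      by simp
  qed
  also have "\<dots> = (if i = j then 1 else 0)"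
  proof -
    \<comment> \<open>Membership in the group gives orthonormal columns, which must be turned into
      orthonormal rows.\<close>
    have "Q 0 * transpose_mat (Q 0) = 1\<^sub>m n"
      using mat_mult_left_right_inverse[of "transpose_mat (Q 0)" n "Q 0"] initial
      by (simp add: orthogonal_group_def)
    then have "(Q 0 * transpose_mat (Q 0)) $$ (i, j) = (if i = j then 1 else 0)"
      using assms by simp
    then show ?thesis
      using carrier[of 0] assms by (simp add: scalar_prod_def atLeast0LessThan q_def)
  qed
  finally show ?thesis .
qed

lemma row_norm: "t \<ge> 0 \<Longrightarrow> i < n \<Longrightarrow> (\<Sum>l<n. (q t i l)\<^sup>2) = 1"
  using rows_orthonormal[of t i i] by (simp add: power2_eq_square)

lemma column_norm: "t \<ge> 0 \<Longrightarrow> j < n \<Longrightarrow> (\<Sum>l<n. (q t l j)\<^sup>2) = 1"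
  using orthonormal_rows_imp_columns[OF carrier[of t], of j j] rows_orthonormal[of t]
  by (simp add: power2_eq_square q_def)

lemma abs_q_le_1:
  assumes "t \<ge> 0" "i < n" "j < n"
  shows "\<bar>q t i j\<bar> \<le> 1"
proof -
  have "(q t i j)\<^sup>2 \<le> (\<Sum>l<n. (q t i l)\<^sup>2)"
    by (rule member_le_sum) (use assms in auto)
  then show ?thesis
    using row_norm[OF assms(1,2)] by (simp add: abs_square_le_1)
qed

text \<open>Uniformity in time supplies the coefficient bound for the Gronwall argument; the factor
  2 comes from the doubled upper part of \<open>U\<close>.\<close>

lemma abs_U_le:
  assumes "t \<ge> 0" "r < n" "c < n"
  shows "\<bar>U t r c\<bar> \<le> 2 * (\<Sum>i<n. \<bar>lam i\<bar>)"
proof -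
  have "\<bar>B t r c\<bar> \<le> (\<Sum>i<n. \<bar>lam i * q t i r * q t i c\<bar>)"
    unfolding B_def by (rule sum_abs)
  also have "\<dots> \<le> (\<Sum>i<n. \<bar>lam i\<bar>)"
  proof (rule sum_mono)
    fix i assume "i \<in> {..<n}"
    then have "\<bar>q t i r\<bar> * \<bar>q t i c\<bar> \<le> 1"
      using abs_q_le_1 assms by (intro mult_le_one) auto
    then show "\<bar>lam i * q t i r * q t i c\<bar> \<le> \<bar>lam i\<bar>"
      using mult_left_le[of "\<bar>q t i r\<bar> * \<bar>q t i c\<bar>" "\<bar>lam i\<bar>"] by (simp add: abs_mult mult.assoc)
  qed
  finally show ?thesis
    by (auto simp: U_def K_def)
qed

text \<open>Since \<open>K = B - U\<close> and \<open>Q Q^T = 1\<close>, the term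
  \<open>Q B = Q Q^T A Q\<close> collapses to \<open>A Q\<close>.\<close>

lemma q_deriv_triangular:
  assumes "t \<ge> 0" "i < n" "j < n"
  shows "((\<lambda>s. q s i j) has_real_derivative lam i * q t i j - (\<Sum>m<n. q t i m * U t m j))
    (at t within {0..})"
proof -
  have "(\<Sum>m<n. q t i m * B t m j) = (\<Sum>l<n. lam l * q t l j * (\<Sum>m<n. q t i m * q t l m))"
    unfolding B_def sum_distrib_left by (subst sum.swap) (simp add: mult_ac)
  also have "\<dots> = (\<Sum>l<n. if l = i then lam l * q t l j else 0)"
    by (rule sum.cong) (auto simp: rows_orthonormal assms)
  also have "\<dots> = lam i * q t i j"
    using \<open>i < n\<close> by simp
  finally have "(\<Sum>m<n. q t i m * K t m j) = lam i * q t i j - (\<Sum>m<n. q t i m * U t m j)"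
    by (simp add: U_def algebra_simps sum_subtractf)
  then show ?thesis
    using q_deriv[OF assms] by simp
qed

text \<open>A linear relation holding on the initial span of the first \<open>k\<close> columns is transported by
  \<open>exp (- t A)\<close> to a relation on the span at time \<open>t\<close>.\<close>

lemma leading_columns_relation:
  assumes zero: "\<And>l. l < k \<Longrightarrow> (\<Sum>i<n. c i * q 0 i l) = 0"
    and "k \<le> n" "t \<ge> 0" "l < k"
  shows "(\<Sum>i<n. c i * exp (- lam i * t) * q t i l) = 0"
proof (rule linear_ode_zero_unique[where I = "{..<k}" and W = "\<lambda>t m l. - U t m l" and l = l and t = t
      and \<beta> = "2 * (\<Sum>i<n. \<bar>lam i\<bar>)"
      and g = "\<lambda>t l. \<Sum>i<n. c i * exp (- lam i * t) * q t i l"])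
  fix t l assume t: "t \<ge> (0::real)" and l: "l \<in> {..<k}"
  let ?e = "\<lambda>i. c i * exp (- lam i * t)"
  have "((\<lambda>t. \<Sum>i<n. c i * exp (- lam i * t) * q t i l) has_real_derivative
      (\<Sum>i<n. ?e i * (lam i * q t i l - (\<Sum>m<n. q t i m * U t m l))
        + (c i * (exp (- lam i * t) * - lam i)) * q t i l)) (at t within {0..})"
    by (intro DERIV_sum DERIV_mult' q_deriv_triangular)
      (use t l \<open>k \<le> n\<close> in \<open>auto intro!: derivative_eq_intros\<close>)
  also have "(\<Sum>i<n. ?e i * (lam i * q t i l - (\<Sum>m<n. q t i m * U t m l))
        + (c i * (exp (- lam i * t) * - lam i)) * q t i l)
      = (\<Sum>i<n. \<Sum>m<n. - U t m l * (?e i * q t i m))"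
    \<comment> \<open>Differentiating the exponential cancels the \<open>lam i\<close> terms,
      leaving \<open>g' = - g U\<close>.\<close>
    by (rule sum.cong) (auto simp: algebra_simps sum_distrib_left sum_negf)
  also have "\<dots> = (\<Sum>m<n. - U t m l * (\<Sum>i<n. ?e i * q t i m))"
    by (subst sum.swap) (simp add: sum_distrib_left)
  \<comment> \<open>Upper triangularity closes the system on the first \<open>k\<close> columns,
    where the initial values vanish.\<close>
  also have "\<dots> = (\<Sum>m<k. - U t m l * (\<Sum>i<n. ?e i * q t i m))"
    using l \<open>k \<le> n\<close> by (intro sum.mono_neutral_right) (auto simp: U_upper_triangular)
  finally show "((\<lambda>t. \<Sum>i<n. c i * exp (- lam i * t) * q t i l) has_real_derivative
      (\<Sum>m<k. - U t m l * (\<Sum>i<n. ?e i * q t i m))) (at t within {0..})" .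
qed (use assms abs_U_le in auto)

section \<open>Exponential decay below the diagonal\<close>

text \<open>Initially row \<open>a\<close>, cut to the first \<open>Suc k\<close> columns, is a
  combination of the first \<open>Suc k\<close> rows. Transport along the flow multiplies the
  coefficient of row \<open>i\<close> by \<open>exp ((lam a - lam i) * t)\<close>.\<close>

lemma lower_left_entry_bound:
  assumes dec: "\<And>i j. i \<le> j \<Longrightarrow> j < n \<Longrightarrow> lam j \<le> lam i"
    and "k < n" and det: "Determinant.det (submatrix (Q 0) {..<Suc k} {..<Suc k}) \<noteq> 0"
    and "k < a" "a < n"
  shows "\<exists>C. \<forall>t\<ge>0. \<forall>l\<le>k. (q t a l)\<^sup>2 \<le> C * exp (- 2 * (lam k - lam (Suc k)) * t)"
proof -
  obtain b where b: "\<And>l. l < Suc k \<Longrightarrow> q 0 a l = (\<Sum>i<Suc k. b i * Q 0 $$ (i, l))"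
    using row_combination_of_leading_rows[OF carrier[of 0] _ det] \<open>k < n\<close>
    by (metis Suc_leI order_refl)
  \<comment> \<open>The vector \<open>c\<close> encodes the relation "row \<open>a\<close> minus its
    combination of leading rows is zero".\<close>
  define c where "c i = (if i = a then 1 else if i < Suc k then - b i else 0)" for i
  have split: "(\<Sum>i<n. c i * f i) = f a - (\<Sum>i<Suc k. b i * f i)" for f :: "nat \<Rightarrow> real"
  proof -
    have "(\<Sum>i<n. c i * f i) = (\<Sum>i\<in>insert a {..<Suc k}. c i * f i)"
      by (rule sum.mono_neutral_right) (use assms in \<open>auto simp: c_def\<close>)
    also have "\<dots> = c a * f a + (\<Sum>i<Suc k. c i * f i)"
      by (rule sum.insert) (use \<open>k < a\<close> in auto)
    also have "(\<Sum>i<Suc k. c i * f i) = - (\<Sum>i<Suc k. b i * f i)"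
      unfolding sum_negf[symmetric] by (rule sum.cong) (use \<open>k < a\<close> in \<open>auto simp: c_def\<close>)
    finally show ?thesis by (simp add: c_def)
  qed
  define S where "S = (\<Sum>i<Suc k. \<bar>b i\<bar>)"
  have "(q t a l)\<^sup>2 \<le> S\<^sup>2 * exp (- 2 * (lam k - lam (Suc k)) * t)" if "t \<ge> 0" "l \<le> k" for t l
  proof -
    let ?d = "exp (- (lam k - lam (Suc k)) * t)"
    have "(\<Sum>i<n. c i * exp (- lam i * t) * q t i l) = 0"
      by (rule leading_columns_relation[where k = "Suc k"])
        (use that \<open>k < n\<close> b in \<open>auto simp: split q_def\<close>)
    then have "exp (- lam a * t) * q t a l = (\<Sum>i<Suc k. b i * (exp (- lam i * t) * q t i l))"
      unfolding mult.assoc split by simp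
    then have "exp (lam a * t) * (exp (- lam a * t) * q t a l)
        = (\<Sum>i<Suc k. b i * (exp (lam a * t) * exp (- lam i * t) * q t i l))"
      by (simp add: sum_distrib_left mult_ac distrib_left)
    then have "q t a l = (\<Sum>i<Suc k. b i * (exp (lam a * t - lam i * t) * q t i l))"
      unfolding mult.assoc[symmetric] exp_add[symmetric] by (simp add: mult.assoc)
    also have "\<bar>\<dots>\<bar> \<le> (\<Sum>i<Suc k. \<bar>b i * (exp (lam a * t - lam i * t) * q t i l)\<bar>)"
      by (rule sum_abs)
    also have "\<dots> \<le> (\<Sum>i<Suc k. \<bar>b i\<bar> * ?d)"
    proof (rule sum_mono)
      fix i assume "i \<in> {..<Suc k}"
      then have "i \<le> k" by simp
      \<comment> \<open>The slowest decay occurs for \<open>i = k\<close> and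
        \<open>a = Suc k\<close>.\<close>
      have "(lam k - lam (Suc k)) * t \<le> (lam i - lam a) * t"
        using dec[OF \<open>i \<le> k\<close> \<open>k < n\<close>] dec[of "Suc k" a] \<open>k < a\<close> \<open>a < n\<close> \<open>t \<ge> 0\<close>
        by (intro mult_right_mono) linarith+
      then have "exp (lam a * t - lam i * t) \<le> ?d"
        by (simp add: algebra_simps)
      moreover have "\<bar>q t i l\<bar> \<le> 1"
        using abs_q_le_1 that \<open>i \<le> k\<close> \<open>k < n\<close> by simp
      ultimately have "exp (lam a * t - lam i * t) * \<bar>q t i l\<bar> \<le> ?d * 1"
        by (intro mult_mono) auto
      then show "\<bar>b i * (exp (lam a * t - lam i * t) * q t i l)\<bar> \<le> \<bar>b i\<bar> * ?d"
        by (simp add: abs_mult mult_left_mono)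
    qed
    also have "\<dots> = S * ?d"
      unfolding S_def by (rule sum_distrib_right[symmetric])
    finally have "\<bar>q t a l\<bar>\<^sup>2 \<le> (S * ?d)\<^sup>2"
      by (rule power_mono) simp
    also have "\<dots> = S\<^sup>2 * exp (- 2 * (lam k - lam (Suc k)) * t)"
      by (simp add: power_mult_distrib exp_double[symmetric] algebra_simps)
    finally show ?thesis by simp
  qed
  then show ?thesis by blast
qed

end

section \<open>Gap rates and the final estimate\<close>

lemma gap_rate_antimono:
  assumes "k \<le> l"
  shows "gap_rate n lam l \<le> gap_rate n lam k"
  unfolding gap_rate_def by (rule Min_antimono) (use assms in auto)

lemma gap_rate_le_gap:
  assumes "Suc k < n"
  shows "gap_rate n lam k \<le> lam k - lam (Suc k)"
  unfolding gap_rate_def using assms by (intro Min_le) auto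

theorem theorem5p3:
  fixes n :: nat and lam :: "nat \<Rightarrow> real" and Q\<^sub>0 :: "real mat" and Q :: "real \<Rightarrow> real mat"
  assumes "n \<ge> 2"
    and "\<And>i. Suc i < n \<Longrightarrow> lam (Suc i) < lam i"
    and "lam (n - 1) > 0"
    and "Q\<^sub>0 \<in> orthogonal_group n"
    and "\<And>k. k \<in> {1..n} \<Longrightarrow> Determinant.det (submatrix Q\<^sub>0 {..<k} {..<k}) \<noteq> 0"
    and "flow_solution n (mat_diag n lam) Q"
    and "Q 0 = Q\<^sub>0"
  shows "\<exists>C>0. \<forall>t\<ge>0. \<forall>i<n. \<forall>j<n.
           \<bar>(Q t $$ (i, j))\<^sup>2 - (if i = j then 1 else 0)\<bar>
             \<le> C * exp (- 2 * gap_rate n lam (min i j) * t)"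
proof -
  interpret qr_flow n lam Q
    using assms by unfold_locales auto
  let ?E = "\<lambda>k t. exp (- 2 * gap_rate n lam k * t)"
  have dec: "lam j \<le> lam i" if "i \<le> j" "j < n" for i j
    using that
  proof (induction j rule: dec_induct)
    case (step j)
    then show ?case using assms(2)[of j] by simp
  qed simp
  have "\<exists>C. \<forall>t\<ge>0. \<forall>l\<le>k. (q t a l)\<^sup>2 \<le> C * exp (- 2 * (lam k - lam (Suc k)) * t)"
    if "k < a" "a < n" for k a
    by (rule lower_left_entry_bound) (use that dec assms(5)[of "Suc k"] assms(7) in auto)
  then obtain D where D: "\<And>k a t l. k < a \<Longrightarrow> a < n \<Longrightarrow> t \<ge> 0 \<Longrightarrow> l \<le> k \<Longrightarrow>
      (q t a l)\<^sup>2 \<le> D k a * exp (- 2 * (lam k - lam (Suc k)) * t)"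
    by metis
  \<comment> \<open>One constant for all blocks. Absolute values are taken because \<open>D\<close>
    is unspecified outside \<open>k < a < n\<close>.\<close>
  define C where "C = (\<Sum>k<n. \<Sum>a<n. \<bar>D k a\<bar>)"
  have "C \<ge> 0"
    unfolding C_def by (intro sum_nonneg) auto
  have lower: "(q t a l)\<^sup>2 \<le> C * ?E k t" if "k < a" "a < n" "t \<ge> 0" "l \<le> k" for k a t l
  proof -
    have "D k a \<le> (\<Sum>a<n. \<bar>D k a\<bar>)"
      using that member_le_sum[of a "{..<n}" "\<lambda>a. \<bar>D k a\<bar>"] by force
    also have "\<dots> \<le> C"
      unfolding C_def using that
      by (intro member_le_sum[of k "{..<n}" "\<lambda>k. \<Sum>a<n. \<bar>D k a\<bar>"]) (auto intro: sum_nonneg)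
    finally have "D k a \<le> C" .
    moreover have "exp (- 2 * (lam k - lam (Suc k)) * t) \<le> ?E k t"
    proof -
      have "gap_rate n lam k * t \<le> (lam k - lam (Suc k)) * t"
        using gap_rate_le_gap[of k n lam] that by (intro mult_right_mono) auto
      then show ?thesis
        by (simp add: algebra_simps)
    qed
    ultimately have "D k a * exp (- 2 * (lam k - lam (Suc k)) * t) \<le> C * ?E k t"
      using \<open>C \<ge> 0\<close> by (intro mult_mono) auto
    then show ?thesis
      using D[OF that] by linarith
  qed
  \<comment> \<open>An off-diagonal block has at most \<open>n\<close> rows and \<open>n\<close>
    columns, each entry contributing at most \<open>C\<close> times the exponential.\<close>
  define M where "M = real n * (real n * C)"
  have "M \<ge> 0"
    using \<open>C \<ge> 0\<close> by (simp add: M_def)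
  have "1 * C \<le> real n * C" "1 * (real n * C) \<le> real n * (real n * C)"
    using \<open>C \<ge> 0\<close> \<open>n \<ge> 2\<close> by (intro mult_right_mono; simp)+
  then have "C \<le> M"
    unfolding M_def by linarith
  have off_diagonal: "(q t i j)\<^sup>2 \<le> M * ?E (min i j) t"
    if "t \<ge> 0" "i < n" "j < n" "i \<noteq> j" for t i j
  proof (cases "j < i")
    case True
    then have "(q t i j)\<^sup>2 \<le> C * ?E j t"
      using that lower by simp
    also have "\<dots> \<le> M * ?E j t"
      using \<open>C \<le> M\<close> by (intro mult_right_mono) auto
    finally show ?thesis
      using True by simp
  next
    case False
    with that have "i < j" by simp
    \<comment> \<open>Above the diagonal there is no direct relation: the entry is bounded by the
      whole upper right block with \<open>Suc i\<close> rows, whose norm equals that of the lower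
      left block decaying at rate \<open>gap_rate n lam i\<close>.\<close>
    have "(q t i j)\<^sup>2 \<le> (\<Sum>j=Suc i..<n. (q t i j)\<^sup>2)"
      by (rule member_le_sum) (use that \<open>i < j\<close> in auto)
    also have "\<dots> \<le> (\<Sum>r<Suc i. \<Sum>j=Suc i..<n. (q t r j)\<^sup>2)"
      using member_le_sum[of i "{..<Suc i}" "\<lambda>r. \<Sum>j=Suc i..<n. (q t r j)\<^sup>2"]
      by (force intro: sum_nonneg)
    also have "\<dots> = (\<Sum>a=Suc i..<n. \<Sum>l<Suc i. (q t a l)\<^sup>2)"
      by (rule orthogonal_off_diagonal_blocks) (use that row_norm column_norm in auto)
    also have "\<dots> \<le> (\<Sum>a=Suc i..<n. \<Sum>l<Suc i. C * ?E i t)"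
      by (intro sum_mono lower) (use that in auto)
    also have "\<dots> = real (n - Suc i) * (real (Suc i) * (C * ?E i t))"
      by simp
    also have "\<dots> \<le> real n * (real n * (C * ?E i t))"
      using that \<open>C \<ge> 0\<close> by (intro mult_mono) auto
    finally show ?thesis
      using \<open>i < j\<close> by (simp add: M_def mult.assoc)
  qed
  have diagonal: "\<bar>(q t i i)\<^sup>2 - 1\<bar> \<le> real n * M * ?E i t" if "t \<ge> 0" "i < n" for t i
  proof -
    \<comment> \<open>The defect of the diagonal entry is the sum of the other squares in its unit
      row.\<close>
    have "1 = (q t i i)\<^sup>2 + (\<Sum>l\<in>{..<n} - {i}. (q t i l)\<^sup>2)"
      using sum.remove[of "{..<n}" i "\<lambda>l. (q t i l)\<^sup>2"] row_norm that by simp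
    moreover have "(\<Sum>l\<in>{..<n} - {i}. (q t i l)\<^sup>2) \<le> (\<Sum>l\<in>{..<n} - {i}. M * ?E i t)"
    proof (rule sum_mono)
      fix l assume l: "l \<in> {..<n} - {i}"
      \<comment> \<open>Entries left of the diagonal decay at rate \<open>gap_rate n lam l\<close>,
        which is at least the rate at \<open>i\<close>.\<close>
      have "gap_rate n lam i * t \<le> gap_rate n lam (min i l) * t"
        using gap_rate_antimono[of "min i l" i] that by (intro mult_right_mono) auto
      then have "?E (min i l) t \<le> ?E i t"
        by simp
      then have "M * ?E (min i l) t \<le> M * ?E i t"
        using \<open>M \<ge> 0\<close> by (rule mult_left_mono)
      then show "(q t i l)\<^sup>2 \<le> M * ?E i t"
        using off_diagonal[of t i l] l that by force
    qed
    moreover have "(\<Sum>l\<in>{..<n} - {i}. M * ?E i t) \<le> real n * M * ?E i t"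
      using \<open>M \<ge> 0\<close> that by (simp add: mult.assoc mult_right_mono)
    moreover have "(\<Sum>l\<in>{..<n} - {i}. (q t i l)\<^sup>2) \<ge> 0"
      by (intro sum_nonneg) auto
    ultimately show ?thesis
      by linarith
  qed
  show ?thesis
  \<comment> \<open>The summand 1 makes the constant strictly positive, since \<open>M\<close> may
    be 0.\<close>
  proof (intro exI[of _ "real n * M + 1"] conjI allI impI)
    show "real n * M + 1 > 0"
      using \<open>M \<ge> 0\<close> by (simp add: add_nonneg_pos)
    fix t :: real and i j
    assume t: "t \<ge> 0" and i: "i < n" and j: "j < n"
    have "1 * M \<le> real n * M"
      using \<open>M \<ge> 0\<close> \<open>n \<ge> 2\<close> by (intro mult_right_mono) auto
    then have C_le: "M * ?E (min i j) t \<le> (real n * M + 1) * ?E (min i j) t"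
      "real n * M * ?E (min i j) t \<le> (real n * M + 1) * ?E (min i j) t"
      by (intro mult_right_mono; simp)+
    show "\<bar>(Q t $$ (i, j))\<^sup>2 - (if i = j then 1 else 0)\<bar> \<le> (real n * M + 1) * ?E (min i j) t"
    proof (cases "i = j")
      case True
      then show ?thesis
        using order_trans[OF diagonal[OF t i]] C_le(2) by (simp add: q_def)
    next
      case False
      then show ?thesis
        using order_trans[OF off_diagonal[OF t i j False] C_le(1)] by (simp add: q_def)
    qed
  qed
qed

end
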